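(* Let $\mathcal{H}_A$ be a finite-dimensional complex Hilbert space and let $\mathcal{H}_{A'}$, $\mathcal{H}_{A''}$ be copies of $\mathcal{H}_A$. Let $\mathcal{E}_{A'A''|A}:\mathfrak{L}(\mathcal{H}_A)\to\mathfrak{L}(\mathcal{H}_{A'}\otimes\mathcal{H}_{A''})$ be a trace-preserving completely positive map that is broadcasting for a pair of density operators $\sigma_1,\sigma_2$ on $\mathcal{H}_A$ with $[\sigma_1,\sigma_2]\neq 0$. Then $\mathcal{E}_{A'A''|A}$ is cloning for a set of nonorthogonal and nonidentical pure states; that is, there is a set of at least two pairwise nonorthogonal and pairwise distinct pure states on $\mathcal{H}_A$ such that $\mathcal{E}_{A'A''|A}$ is cloning for each state in the set.
   Context: $\mathfrak{L}(\mathcal{H})$ is the space of linear operators on $\mathcal{H}$. A trace-preserving completely positive map $\mathcal{E}_{A'A''|A}:\mathfrak{L}(\mathcal{H}_A)\to\mathfrak{L}(\mathcal{H}_{A'}\otimes\mathcal{H}_{A''})$ is broadcasting for a density operator $\rho$ on $\mathcal{H}_A$ if $\mathrm{Tr}_{A''}(\mathcal{E}_{A'A''|A}(\rho))=\rho$ and $\mathrm{Tr}_{A'}(\mathcal{E}_{A'A''|A}(\rho))=\rho$ (identifying the three copies of the Hilbert space). It is cloning for $\rho$ if $\mathcal{E}_{A'A''|A}(\rho)=\rho\otimes\rho$. Two pure states $|\psi\rangle\langle\psi|$ and $|\phi\rangle\langle\phi|$ (unit vectors) are nonorthogonal and nonidentical when $0<|\langle\psi|\phi\rangle|<1$. *)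

theory Defs
  imports "HOL-Analysis.Analysis"
begin

text \<open>
  A finite-dimensional Hilbert space is taken to be \<open>complex ^ 'n\<close>, so that the type
  variable \<open>'n\<close> ranges over all (positive) dimensions and operators are square matrices. The tensor
  product of two copies is \<open>complex ^ ('n \<times> 'n)\<close>; the first index component belongs to
  \<open>A'\<close>, the second to \<open>A''\<close>.
\<close>

type_synonym 'n operator = "complex ^ 'n ^ 'n"

definition cinner :: "complex ^ 'n \<Rightarrow> complex ^ 'n \<Rightarrow> complex" where
  "cinner \<psi> \<phi> = (\<Sum>i\<in>UNIV. cnj (\<psi> $ i) * \<phi> $ i)"

definition op_scale :: "complex \<Rightarrow> ('n::finite) operator \<Rightarrow> 'n operator" where
  "op_scale c X = (\<chi> i j. c * X $ i $ j)"

text \<open>Over the complex numbers the following condition already entails self-adjointness.\<close>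

definition positive_op :: "('n::finite) operator \<Rightarrow> bool" where
  "positive_op X \<longleftrightarrow> (\<forall>\<psi>. cinner \<psi> (X *v \<psi>) \<in> \<real>\<^sub>\<ge>\<^sub>0)"

definition density_operator :: "('n::finite) operator \<Rightarrow> bool" where
  "density_operator \<rho> \<longleftrightarrow> positive_op \<rho> \<and> trace \<rho> = 1"

text \<open>
  An operator on \<open>\<complex>\<^sup>k \<otimes> H\<close> is a \<open>k \<times> k\<close> array of operators \<open>X i j\<close> on \<open>H\<close>
  (\<open>i, j < k\<close>), a vector is a family \<open>v i\<close>, and \<open>id \<otimes> \<E>\<close> acts by applying \<open>\<E>\<close> to every
  block. The ancilla is indexed by natural numbers because its dimension has to be quantified inside
  the definition.
\<close>

definition positive_block :: "nat \<Rightarrow> (nat \<Rightarrow> nat \<Rightarrow> ('n::finite) operator) \<Rightarrow> bool" where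
  "positive_block k X \<longleftrightarrow>
     (\<forall>v. (\<Sum>i<k. \<Sum>j<k. cinner (v i) (X i j *v v j)) \<in> \<real>\<^sub>\<ge>\<^sub>0)"

definition completely_positive :: "(('n::finite) operator \<Rightarrow> ('m::finite) operator) \<Rightarrow> bool" where
  "completely_positive \<E> \<longleftrightarrow> Vector_Spaces.linear op_scale op_scale \<E> \<and>
     (\<forall>k X. positive_block k X \<longrightarrow> positive_block k (\<lambda>i j. \<E> (X i j)))"

definition trace_preserving :: "(('n::finite) operator \<Rightarrow> ('m::finite) operator) \<Rightarrow> bool" where
  "trace_preserving \<E> \<longleftrightarrow> (\<forall>X. trace (\<E> X) = trace X)"

definition tensor_op :: "('n::finite) operator \<Rightarrow> ('m::finite) operator \<Rightarrow> ('n \<times> 'm) operator" where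
  "tensor_op X Y = (\<chi> p q. X $ fst p $ fst q * Y $ snd p $ snd q)"

definition trace_out_snd :: "('n::finite \<times> 'm::finite) operator \<Rightarrow> 'n operator" where
  "trace_out_snd X = (\<chi> i j. \<Sum>k\<in>UNIV. X $ (i, k) $ (j, k))"

definition trace_out_fst :: "('n::finite \<times> 'm::finite) operator \<Rightarrow> 'm operator" where
  "trace_out_fst X = (\<chi> i j. \<Sum>k\<in>UNIV. X $ (k, i) $ (k, j))"

definition broadcasting :: "(('n::finite) operator \<Rightarrow> ('n \<times> 'n) operator) \<Rightarrow> 'n operator \<Rightarrow> bool" where
  "broadcasting \<E> \<rho> \<longleftrightarrow> trace_out_snd (\<E> \<rho>) = \<rho> \<and> trace_out_fst (\<E> \<rho>) = \<rho>"

definition cloning :: "(('n::finite) operator \<Rightarrow> ('n \<times> 'n) operator) \<Rightarrow> 'n operator \<Rightarrow> bool" where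
  "cloning \<E> \<rho> \<longleftrightarrow> \<E> \<rho> = tensor_op \<rho> \<rho>"

definition ket_bra :: "complex ^ 'n \<Rightarrow> 'n operator" where
  "ket_bra \<psi> = (\<chi> i j. \<psi> $ i * cnj (\<psi> $ j))"

definition pure_state :: "('n::finite) operator \<Rightarrow> bool" where
  "pure_state P \<longleftrightarrow> (\<exists>\<psi>. norm \<psi> = 1 \<and> P = ket_bra \<psi>)"

text \<open>The representing unit vectors are unique up to a phase, which does not affect the overlap.\<close>

definition nonorthogonal_nonidentical :: "('n::finite) operator \<Rightarrow> 'n operator \<Rightarrow> bool" where
  "nonorthogonal_nonidentical P Q \<longleftrightarrow>
     (\<exists>\<psi> \<phi>. norm \<psi> = 1 \<and> norm \<phi> = 1 \<and> P = ket_bra \<psi> \<and> Q = ket_bra \<phi> \<and>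
            0 < cmod (cinner \<psi> \<phi>) \<and> cmod (cinner \<psi> \<phi>) < 1)"

text \<open>
  The predicate \<open>Vector_Spaces.linear\<close> includes the vector space axioms of both
  scalar multiplications; they always hold here, so it only expresses complex linearity.
\<close>

lemma vector_space_op_scale: "vector_space op_scale"
  by unfold_locales (auto simp: op_scale_def vec_eq_iff algebra_simps)

lemma linear_op_scale_iff:
  "Vector_Spaces.linear op_scale op_scale \<E> \<longleftrightarrow>
     (\<forall>X Y. \<E> (X + Y) = \<E> X + \<E> Y) \<and> (\<forall>c X. \<E> (op_scale c X) = op_scale c (\<E> X))"
  by (auto simp: Vector_Spaces.linear_def module_hom_def module_hom_axioms_def
      vector_space_op_scale module_iff_vector_space)

end

theory Submission imports Defs begin

text \<open>
  The hypotheses are contradictory: this is the no-broadcasting theorem. Averaging \<open>\<E>\<close> with its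
  composition with the swap gives a map \<open>G\<close> whose two marginals coincide; call \<open>F\<close> the common
  marginal channel (\<open>marginal\<close> below). Broadcast states are fixed by \<open>F\<close>. A Cesaro limit of the
  powers of \<open>F\<close> is a positive trace-preserving projection \<open>P\<close> onto the fixed operators.

  Let \<open>\<rho>\<close> be an extreme point of the compact convex set of fixed states. Measuring \<open>v\<close> on one factor of
  \<open>G \<rho>\<close> and applying \<open>P\<close> to the other one yields a fixed operator dominated by a multiple of \<open>\<rho>\<close>,
  hence equal to \<open>\<langle>v, \<rho> v\<rangle> \<rho>\<close>. So the extreme points are eigenvectors of a family of linear maps, with
  eigenvalues that separate them, and therefore they are linearly independent. The functional that is
  1 on one extreme point and 0 on the others, composed with \<open>P\<close>, is then an effect that
  perfectly distinguishes that point from the others. Hence distinct extreme points are orthogonal, and by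
  Krein-Milman all fixed states commute.
\<close>

subsection \<open>Mean ergodic projections and separated eigenvectors\<close>

text \<open>Mean ergodic argument in finite dimension: bounded orbits make the averages a bounded
  set of operators, so a subsequence converges. Applying \<open>F\<close> changes the average of a
  vector by O(1/n), hence the limit is \<open>F\<close>-fixed. The clause on \<open>K\<close> later
  transfers positivity and trace to \<open>P\<close>.\<close>

lemma cesaro_projection:
  fixes F :: "'a::euclidean_space \<Rightarrow> 'a"
  assumes F: "linear F" and orb: "\<And>x. \<exists>C. \<forall>k. norm ((F ^^ k) x) \<le> C"
  obtains P where "linear P" "\<And>x. F (P x) = P x" "\<And>x. F x = x \<Longrightarrow> P x = x"
    "\<And>K x. closed K \<Longrightarrow> convex K \<Longrightarrow> F ` K \<subseteq> K \<Longrightarrow> x \<in> K \<Longrightarrow> P x \<in> K"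
proof -
  have linpow: "linear (F ^^ k)" for k
  proof (induction k)
    case (Suc k)
    then show ?case using linear_compose[OF Suc F] by (simp add: o_def)
  qed (simp add: linear_ident)
  define a where "a n x = (\<Sum>k\<le>n. (F ^^ k) x) /\<^sub>R real (Suc n)" for n x
  have lina: "linear (a n)" for n
    unfolding a_def [abs_def]
    by (intro linear_compose_scale_right linear_compose_sum ballI linpow)
  \<comment> \<open>Viewing the averages as elements of the finite-dimensional space of bounded
    operators yields one subsequence that works for all \<open>x\<close>.\<close>
  define A where "A n = Blinfun (a n)" for n
  have A: "blinfun_apply (A n) = a n" for n
    unfolding A_def by (intro bounded_linear_Blinfun_apply) (simp add: lina linear_conv_bounded_linear [symmetric])
  obtain C where C: "\<And>x k. norm ((F ^^ k) x) \<le> C x"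
    using orb by metis
  have a_bd: "norm (a n x) \<le> C x" for n x
  proof -
    have "norm (\<Sum>k\<le>n. (F ^^ k) x) \<le> (\<Sum>k\<le>n. C x)"
      by (intro order_trans[OF norm_sum] sum_mono C)
    also have "\<dots> = real (Suc n) * C x" by simp
    finally show ?thesis
      unfolding a_def by (simp add: divide_simps mult.commute del: of_nat_Suc)
  qed
  have "bounded (range A)"
    unfolding bounded_iff
  proof (intro exI ballI)
    fix y assume "y \<in> range A"
    then obtain n where y: "y = A n" by blast
    have "norm y \<le> (\<Sum>b\<in>Basis. norm (blinfun_apply y b))"
      by (rule norm_blinfun_euclidean_le)
    also have "\<dots> \<le> (\<Sum>b\<in>Basis. C b)"
      by (intro sum_mono) (simp add: y A a_bd)
    finally show "norm y \<le> (\<Sum>b\<in>Basis. C b)" .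
  qed
  then obtain L r where r: "strict_mono r" and L: "(A \<circ> r) \<longlonglongrightarrow> L"
    using bounded_imp_convergent_subsequence by blast
  have lim: "(\<lambda>n. a (r n) x) \<longlonglongrightarrow> blinfun_apply L x" for x
  proof -
    have "(\<lambda>n. blinfun_apply ((A \<circ> r) n) x) \<longlonglongrightarrow> blinfun_apply L x"
      by (intro blinfun.tendsto L tendsto_const)
    then show ?thesis by (simp add: A)
  qed
  have cont: "isCont F x" for x
    using F by (simp add: linear_continuous_at linear_conv_bounded_linear)
  have shift: "F (a n x) - a n x = ((F ^^ Suc n) x - x) /\<^sub>R real (Suc n)" for n x
  proof -
    have "F (a n x) = (\<Sum>k\<le>n. (F ^^ Suc k) x) /\<^sub>R real (Suc n)"
      unfolding a_def using F by (simp add: linear_cmul linear_sum)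
    then have "F (a n x) - a n x = (\<Sum>k\<le>n. (F ^^ Suc k) x - (F ^^ k) x) /\<^sub>R real (Suc n)"
      unfolding a_def by (simp add: sum_subtractf algebra_simps)
    also have "(\<Sum>k\<le>n. (F ^^ Suc k) x - (F ^^ k) x) = (F ^^ Suc n) x - (F ^^ 0) x"
      by (induction n) auto
    finally show ?thesis by simp
  qed
  have shift0: "(\<lambda>n. F (a n x) - a n x) \<longlonglongrightarrow> 0" for x
  proof (rule Lim_null_comparison)
    show "\<forall>\<^sub>F n in sequentially. norm (F (a n x) - a n x) \<le> (C x + norm x) / real (Suc n)"
    proof (intro always_eventually allI)
      fix n
      have "norm ((F ^^ Suc n) x - x) \<le> C x + norm x"
        using C[of "Suc n" x] norm_triangle_ineq4[of "(F ^^ Suc n) x" x] by linarith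
      then show "norm (F (a n x) - a n x) \<le> (C x + norm x) / real (Suc n)"
        unfolding shift by (simp add: divide_simps mult.commute del: of_nat_Suc funpow.simps)
    qed
    show "(\<lambda>n. (C x + norm x) / real (Suc n)) \<longlonglongrightarrow> 0"
      using LIMSEQ_Suc[OF lim_const_over_n[of "C x + norm x"]] by simp
  qed
  show thesis
  proof
    show "linear (blinfun_apply L)"
      by (simp add: blinfun.bounded_linear_right linear_conv_bounded_linear)
    show "F (L x) = L x" for x
    proof -
      have "(\<lambda>n. F (a (r n) x) - a (r n) x) \<longlonglongrightarrow> F (L x) - L x"
        by (intro tendsto_diff lim isCont_tendsto_compose[OF cont lim])
      moreover have "(\<lambda>n. F (a (r n) x) - a (r n) x) \<longlonglongrightarrow> 0"
        using LIMSEQ_subseq_LIMSEQ[OF shift0 r, of x] by (simp add: o_def)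
      ultimately show ?thesis
        using LIMSEQ_unique by fastforce
    qed
    show "L x = x" if "F x = x" for x
    proof -
      have "(F ^^ k) x = x" for k by (induction k) (auto simp: that)
      then have "a n x = x" for n
        unfolding a_def by (simp add: scaleR_conv_of_real sum_constant_scaleR del: of_nat_Suc)
      then show ?thesis using lim[of x] by (simp add: LIMSEQ_const_iff)
    qed
    show "L x \<in> K" if "closed K" "convex K" "F ` K \<subseteq> K" "x \<in> K" for K x
    proof -
      have pow: "(F ^^ k) x \<in> K" for k using that by (induction k) auto
      have "a n x \<in> K" for n
      proof -
        have "(\<Sum>k\<le>n. (1 / real (Suc n)) *\<^sub>R (F ^^ k) x) \<in> K"
          using that(2) by (intro convex_sum pow) (auto simp: divide_simps)
        then show ?thesis
          unfolding a_def by (simp add: scaleR_sum_right divide_inverse)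
      qed
      then show ?thesis
        using closed_sequentially [OF that(1) _ lim [of x]] by auto
    qed
  qed
qed

text \<open>Variant of the independence of eigenvectors for distinct eigenvalues: the operator
  \<open>L v\<close> that tells two vectors apart may depend on the pair.\<close>

lemma independent_if_separated_eigenvectors:
  fixes B :: "'a::real_vector set" and q :: "'i \<Rightarrow> 'a \<Rightarrow> real"
  assumes lin: "\<And>v. linear (L v)"
    and eig: "\<And>v b. b \<in> B \<Longrightarrow> L v b = q v b *\<^sub>R b"
    and sep: "\<And>b c. b \<in> B \<Longrightarrow> c \<in> B \<Longrightarrow> (\<And>v. q v b = q v c) \<Longrightarrow> b = c"
    and "0 \<notin> B"
  shows "independent B"
proof -
  have *: "\<forall>b\<in>A. u b = 0"
    if "finite A" "A \<subseteq> B" "(\<Sum>b\<in>A. u b *\<^sub>R b) = 0" for A u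
    using that
  proof (induction A arbitrary: u rule: finite_induct)
    case (insert b0 A)
    have "u b = 0" if b: "b \<in> A" for b
    proof -
      have "b \<noteq> b0" "b \<in> B" "b0 \<in> B" using insert b by auto
      then obtain v where v: "q v b \<noteq> q v b0" using sep by blast
      have "L v (\<Sum>b\<in>insert b0 A. u b *\<^sub>R b) = (\<Sum>b\<in>insert b0 A. (u b * q v b) *\<^sub>R b)"
        unfolding linear_sum[OF lin] linear_cmul[OF lin]
        using insert.prems(1) by (intro sum.cong refl) (auto simp: eig)
      then have "(\<Sum>b\<in>insert b0 A. (u b * q v b) *\<^sub>R b) = 0"
        using insert.prems linear_0[OF lin] by metis
      moreover have "(\<Sum>b\<in>insert b0 A. (u b * q v b0) *\<^sub>R b) = q v b0 *\<^sub>R (\<Sum>b\<in>insert b0 A. u b *\<^sub>R b)"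
        by (simp add: scaleR_sum_right mult.commute del: sum.insert)
      \<comment> \<open>Subtracting \<open>q v b0\<close> times the relation from its image under
        \<open>L v\<close> removes the term of \<open>b0\<close>, so the induction hypothesis
        applies to \<open>A\<close>.\<close>
      ultimately have "(\<Sum>b\<in>insert b0 A. (u b * (q v b - q v b0)) *\<^sub>R b) = 0"
        using insert.prems by (simp add: algebra_simps sum_subtractf del: sum.insert)
      then have "(\<Sum>b\<in>A. (u b * (q v b - q v b0)) *\<^sub>R b) = 0"
        using insert.hyps by simp
      then have "u b * (q v b - q v b0) = 0"
        using insert.IH[of "\<lambda>b. u b * (q v b - q v b0)"] insert.prems b by blast
      with v show ?thesis by simp
    qed
    then show ?case using insert \<open>0 \<notin> B\<close> by auto
  qed simp
  show ?thesis
    unfolding independent_explicit_module using * by blast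
qed

subsection \<open>Positive operators\<close>

lemma cinner_add_right: "cinner v (w + w') = cinner v w + cinner v w'"
  by (simp add: cinner_def ring_distribs sum.distrib)

lemma cinner_add_left: "cinner (v + v') w = cinner v w + cinner v' w"
  by (simp add: cinner_def ring_distribs sum.distrib)

lemma cinner_diff_right: "cinner v (w - w') = cinner v w - cinner v w'"
  by (simp add: cinner_def ring_distribs sum_subtractf)

lemma cinner_scale_right: "cinner v (c *s w) = c * cinner v w"
  by (simp add: cinner_def sum_distrib_left algebra_simps)

lemma cinner_scale_left: "cinner (c *s v) w = cnj c * cinner v w"
  by (simp add: cinner_def sum_distrib_left algebra_simps)

lemma cnj_cinner: "cnj (cinner v w) = cinner w v"
  by (simp add: cinner_def mult.commute)

lemma cinner_self: "cinner v v = of_real ((norm v)\<^sup>2)"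
  by (simp add: cinner_def norm_vec_def L2_set_def sum_nonneg complex_norm_square mult.commute
      del: of_real_power)

lemma cinner_axis_left: "cinner (axis i 1) w = w $ i"
  by (simp add: cinner_def axis_def if_distrib [of cnj] if_distrib [of "\<lambda>x. x * _"] cong: if_cong)

lemma norm_cinner_le: "cmod (cinner v w) \<le> norm v * norm w"
proof -
  have "cmod (cinner v w) \<le> (\<Sum>i\<in>UNIV. \<bar>cmod (v $ i)\<bar> * \<bar>cmod (w $ i)\<bar>)"
    unfolding cinner_def by (rule order_trans [OF norm_sum]) (simp add: norm_mult)
  also have "\<dots> \<le> norm v * norm w"
    unfolding norm_vec_def by (rule L2_set_mult_ineq)
  finally show ?thesis .
qed

lemma matrix_vector_axis: "((X :: complex ^ 'n ^ 'm) *v axis j 1) $ i = X $ i $ j"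
  by (simp add: matrix_vector_mult_def axis_def if_distrib [of "\<lambda>x. _ * x"] cong: if_cong)

lemma cinner_axis_axis: "cinner (axis i 1) (X *v axis j 1) = X $ i $ j"
  by (simp add: cinner_axis_left matrix_vector_axis)

lemma trace_eq_sum_cinner:
  "trace X = (\<Sum>i\<in>UNIV. cinner (axis i 1) (X *v axis i 1))" for X :: "'n::finite operator"
  by (simp add: cinner_axis_axis trace_def)

lemma ket_bra_mult_vec: "ket_bra u *v v = cinner u v *s u"
  by (simp add: vec_eq_iff ket_bra_def matrix_vector_mult_def cinner_def sum_distrib_left
      sum_distrib_right algebra_simps)

lemma cinner_ket_bra: "cinner v (ket_bra u *v v) = of_real ((cmod (cinner u v))\<^sup>2)"
  by (simp add: ket_bra_mult_vec cinner_scale_right cnj_cinner [of u v, symmetric] complex_norm_square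
    del: of_real_power)

lemma positive_ket_bra: "positive_op (ket_bra u)"
  by (simp add: positive_op_def cinner_ket_bra complex_nonneg_Reals_iff del: of_real_power)

lemma trace_ket_bra: "trace (ket_bra u) = of_real ((norm u)\<^sup>2)"
  unfolding cinner_self [symmetric] by (simp add: trace_def ket_bra_def cinner_def mult.commute)

lemma ket_bra_mult_ket_bra_eq_0: "ket_bra u ** ket_bra v = 0" if "cinner u v = 0"
proof -
  have "(\<Sum>k\<in>UNIV. u $ i * cnj (u $ k) * (v $ k * cnj (v $ j))) = u $ i * cinner u v * cnj (v $ j)" for i j
    by (simp add: cinner_def sum_distrib_left sum_distrib_right algebra_simps)
  then show ?thesis
    by (simp add: that vec_eq_iff matrix_matrix_mult_def ket_bra_def)
qed

lemma norm_ket_bra: "norm (ket_bra u) = (norm u)\<^sup>2"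
proof -
  have "norm (ket_bra u $ i) = cmod (u $ i) * norm u" for i
    by (simp add: ket_bra_def norm_vec_def norm_mult L2_set_right_distrib)
  then show ?thesis
    by (simp add: norm_vec_def [of "ket_bra u"] L2_set_left_distrib [symmetric] norm_vec_def [symmetric] power2_eq_square)
qed

lemma cinner_scaleR_mult_vec:
  "cinner v ((r *\<^sub>R X) *v w) = of_real r * cinner v (X *v w)" for X :: "'n::finite operator"
  by (simp add: cinner_def matrix_vector_mult_def sum_distrib_left scaleR_conv_of_real [where 'a = complex] algebra_simps)

lemma positive_opD:
  assumes "positive_op X"
  shows "0 \<le> Re (cinner v (X *v v))" "Im (cinner v (X *v v)) = 0"
    "cinner v (X *v v) = of_real (Re (cinner v (X *v v)))"
  using assms by (auto simp: positive_op_def complex_nonneg_Reals_iff complex_eq_iff)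

lemma positive_op_0: "positive_op 0"
  by (simp add: positive_op_def cinner_def)

lemma positive_op_add: "positive_op X \<Longrightarrow> positive_op Y \<Longrightarrow> positive_op (X + Y)"
  by (simp add: positive_op_def matrix_vector_mult_add_rdistrib cinner_add_right
      complex_nonneg_Reals_iff)

lemma positive_op_scaleR: "positive_op X \<Longrightarrow> 0 \<le> r \<Longrightarrow> positive_op (r *\<^sub>R X)"
  by (simp add: positive_op_def cinner_scaleR_mult_vec complex_nonneg_Reals_iff)

text \<open>The form at \<open>v + c *s w\<close> is real for every \<open>c\<close>; the choices 1
  and \<i> relate the imaginary and the real parts of the two cross terms.\<close>

lemma positive_op_hermitian:
  assumes "positive_op X"
  shows "cnj (cinner v (X *v w)) = cinner w (X *v v)"
proof -
  have eq: "cinner (v + c *s w) (X *v (v + c *s w)) =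
      cinner v (X *v v) + c * cinner v (X *v w) + cnj c * cinner w (X *v v)
      + cnj c * c * cinner w (X *v w)" for c
    by (simp add: matrix_vector_right_distrib vector_scalar_commute cinner_add_left
        cinner_add_right cinner_scale_left cinner_scale_right algebra_simps)
  have "Im (c * cinner v (X *v w) + cnj c * cinner w (X *v v)) = 0" for c
    using arg_cong [OF eq [of c], of Im] positive_opD(2) [OF assms, of "v + c *s w"]
      positive_opD(2) [OF assms, of v] positive_opD(2) [OF assms, of w]
    by (simp add: algebra_simps)
  from this [of 1] this [of \<i>] show ?thesis by (simp add: complex_eq_iff)
qed

lemma positive_op_hermitian_entry: "positive_op X \<Longrightarrow> cnj (X $ i $ j) = X $ j $ i"
  using positive_op_hermitian [of X "axis i 1" "axis j 1"] by (simp add: cinner_axis_axis)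

text \<open>Schur complement: the form of the difference at \<open>v\<close> is the minimum over
  \<open>c\<close> of the form of \<open>X\<close> at \<open>v + c *s axis i 1\<close>, which is
  nonnegative.\<close>

lemma positive_op_peel:
  assumes X: "positive_op X" and d: "X $ i $ i = of_real d" "d > 0"
    and u: "u = of_real (1 / sqrt d) *s (X *v axis i 1)"
  shows "positive_op (X - ket_bra u)"
  unfolding positive_op_def
proof
  fix v
  let ?e = "axis i 1 :: complex ^ 'a"
  define b where "b = cinner ?e (X *v v)"
  \<comment> \<open>The minimiser, found by completing the square.\<close>
  define c where "c = - b / of_real d"
  have "cinner v (X *v ?e) = cnj b"
    unfolding b_def by (simp add: positive_op_hermitian [OF X])
  then have "cinner (v + c *s ?e) (X *v (v + c *s ?e)) =
      cinner v (X *v v) + c * cnj b + cnj c * b + cnj c * c * of_real d"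
    using d by (simp add: matrix_vector_right_distrib vector_scalar_commute cinner_add_left
        cinner_add_right cinner_scale_left cinner_scale_right b_def [symmetric] cinner_axis_axis algebra_simps)
  also have "\<dots> = cinner v (X *v v) - b * cnj b / of_real d"
    using d by (simp add: c_def field_simps)
  also have "b * cnj b / of_real d = cinner v (ket_bra u *v v)"
  proof -
    have "cinner u v = of_real (1 / sqrt d) * b"
      unfolding u b_def by (metis cinner_scale_left complex_cnj_complex_of_real cnj_cinner positive_op_hermitian [OF X])
    then have "cinner v (ket_bra u *v v) = of_real ((cmod b)\<^sup>2 / d)"
      using d by (simp add: cinner_ket_bra norm_mult norm_divide power_divide)
    then show ?thesis by (simp only: of_real_divide complex_norm_square)
  qed
  finally show "cinner v ((X - ket_bra u) *v v) \<in> \<real>\<^sub>\<ge>\<^sub>0"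
    using X by (metis positive_op_def cinner_diff_right matrix_vector_mult_diff_rdistrib)
qed

text \<open>Cholesky decomposition: each step clears a nonzero diagonal entry.\<close>

lemma positive_op_eq_sum_ket_bra:
  fixes X :: "'n::finite operator"
  assumes "positive_op X"
  shows "\<exists>us. X = (\<Sum>u\<leftarrow>us. ket_bra u)"
  using assms
proof (induction "card {i. X $ i $ i \<noteq> 0}" arbitrary: X rule: less_induct)
  case less
  have diag: "\<exists>d\<ge>0. X $ i $ i = of_real d" for i
    using positive_opD [OF less.prems, of "axis i 1"] by (metis cinner_axis_axis)
  \<comment> \<open>A zero on the diagonal forces its whole row to vanish; peeling then cannot
    disturb diagonal entries that are already zero.\<close>
  have col0: "X $ j $ i = 0" if j: "X $ j $ j = 0" for i j
  proof (cases "X $ i $ i = 0")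
    case True
    let ?v = "\<lambda>c. axis j 1 + c *s axis i 1 :: complex ^ 'n"
    have "cinner (?v c) (X *v ?v c) = c * X $ j $ i + cnj c * cnj (X $ j $ i)" for c
      by (simp add: matrix_vector_right_distrib vector_scalar_commute cinner_add_left
          cinner_add_right cinner_scale_left cinner_scale_right cinner_axis_axis True j
          positive_op_hermitian_entry [OF less.prems])
    then have "0 \<le> Re (c * X $ j $ i + cnj c * cnj (X $ j $ i))" for c
      using positive_opD(1) [OF less.prems] by metis
    \<comment> \<open>This \<open>c\<close> turns the form into minus twice the squared modulus of
      the entry.\<close>
    from this [of "- cnj (X $ j $ i)"] have "(cmod (X $ j $ i))\<^sup>2 \<le> 0"
      unfolding cmod_power2 by (simp add: power2_eq_square)
    then show ?thesis by simp
  next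
    case False
    obtain d where d: "0 \<le> d" "X $ i $ i = of_real d" using diag by blast
    with False have "d > 0" by auto
    \<comment> \<open>After peeling at \<open>i\<close> the diagonal entry at \<open>j\<close> is
      minus the squared modulus of \<open>X $ j $ i\<close> over \<open>d\<close>.\<close>
    from positive_op_peel [OF less.prems d(2) this refl]
    have "0 \<le> Re (cinner (axis j 1) ((X - ket_bra (of_real (1 / sqrt d) *s (X *v axis i 1))) *v axis j 1))"
      by (rule positive_opD)
    then have "(cmod (X $ j $ i))\<^sup>2 / d \<le> 0"
      using \<open>d > 0\<close> unfolding cmod_power2
      by (simp add: cinner_axis_axis j ket_bra_def matrix_vector_axis field_simps power2_eq_square)
    then show ?thesis using \<open>d > 0\<close> by (simp add: divide_le_0_iff)
  qed
  show ?case
  proof (cases "\<exists>i. X $ i $ i \<noteq> 0")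
    case False
    then have "X = 0" by (simp add: vec_eq_iff col0)
    then show ?thesis by (metis list.map(1) sum_list.Nil)
  next
    case True
    then obtain i where i: "X $ i $ i \<noteq> 0" by blast
    obtain d where d: "0 \<le> d" "X $ i $ i = of_real d" using diag by blast
    with i have "d > 0" by auto
    define u where "u = of_real (1 / sqrt d) *s (X *v axis i 1)"
    let ?Y = "X - ket_bra u"
    have Y: "positive_op ?Y"
      by (rule positive_op_peel [OF less.prems d(2) \<open>d > 0\<close> u_def])
    have uj: "u $ j = X $ j $ i / of_real (sqrt d)" for j
      by (simp add: u_def matrix_vector_axis)
    have "?Y $ i $ i = 0"
      using \<open>d > 0\<close> d(2) by (simp add: ket_bra_def uj flip: of_real_mult)
    moreover have "?Y $ j $ j = 0" if "X $ j $ j = 0" for j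
      using col0 [OF that] that by (simp add: ket_bra_def uj)
    ultimately have "{j. ?Y $ j $ j \<noteq> 0} \<subset> {j. X $ j $ j \<noteq> 0}"
      using i by blast
    then have "card {j. ?Y $ j $ j \<noteq> 0} < card {j. X $ j $ j \<noteq> 0}"
      by (simp add: psubset_card_mono)
    from less.hyps [OF this Y] obtain us where "?Y = (\<Sum>u\<leftarrow>us. ket_bra u)" by blast
    then have "X = (\<Sum>u\<leftarrow>u # us. ket_bra u)" by (simp add: algebra_simps)
    then show ?thesis by blast
  qed
qed

lemma trace_scaleR: "trace (r *\<^sub>R X) = of_real r * trace X" for X :: "'n::finite operator"
  by (simp add: trace_def sum_distrib_left scaleR_conv_of_real [where 'a = complex])

lemma trace_positive:
  assumes "positive_op X"
  shows "0 \<le> Re (trace X)" "trace X = of_real (Re (trace X))"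
proof -
  show "0 \<le> Re (trace X)"
    by (simp add: trace_eq_sum_cinner sum_nonneg positive_opD(1) [OF assms])
  show "trace X = of_real (Re (trace X))"
    by (simp add: trace_eq_sum_cinner complex_eq_iff positive_opD(2) [OF assms])
qed

text \<open>For a rank-one term norm and trace coincide; the triangle inequality handles the sum.
  This turns trace preservation into boundedness.\<close>

lemma norm_positive_op_le_trace: "norm X \<le> Re (trace X)" if X: "positive_op X"
proof -
  obtain us where us: "X = (\<Sum>u\<leftarrow>us. ket_bra u)" using positive_op_eq_sum_ket_bra [OF X] by blast
  show ?thesis
    unfolding us
  proof (induction us)
    case (Cons u us)
    then show ?case
      using norm_triangle_ineq [of "ket_bra u" "\<Sum>u\<leftarrow>us. ket_bra u"]
      by (simp add: trace_add norm_ket_bra trace_ket_bra del: of_real_power)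
  qed (simp add: trace_def)
qed

lemma positive_trace_0: "positive_op X \<Longrightarrow> Re (trace X) = 0 \<Longrightarrow> X = 0"
  using norm_positive_op_le_trace [of X] by simp

text \<open>Cauchy-Schwarz on each rank-one summand; in operator terms, a positive operator is at
  most its trace times the identity.\<close>

lemma cinner_le_trace: "Re (cinner v (X *v v)) \<le> (norm v)\<^sup>2 * Re (trace X)" if X: "positive_op X"
proof -
  obtain us where us: "X = (\<Sum>u\<leftarrow>us. ket_bra u)" using positive_op_eq_sum_ket_bra [OF X] by blast
  show ?thesis
    unfolding us
  proof (induction us)
    case (Cons u us)
    have "(cmod (cinner u v))\<^sup>2 \<le> (norm v)\<^sup>2 * (norm u)\<^sup>2"
      using power_mono [OF norm_cinner_le, of u v 2] by (simp add: power_mult_distrib mult.commute)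
    with Cons show ?case
      by (simp add: trace_add cinner_ket_bra trace_ket_bra matrix_vector_mult_add_rdistrib
        cinner_add_right ring_distribs del: of_real_power)
  qed (simp add: trace_def cinner_def)
qed

section \<open>Topology of the positive cone, and spanning by rank-one operators\<close>

lemma continuous_on_cinner_mult_vec: "continuous_on A (\<lambda>X. cinner v (X *v w))" for A :: "'n::finite operator set"
  unfolding cinner_def matrix_vector_mult_def by (intro continuous_intros)

lemma closed_positive_op: "closed {X :: 'n::finite operator. positive_op X}"
proof -
  have "closed {X :: 'n operator. cinner v (X *v v) \<in> \<real>\<^sub>\<ge>\<^sub>0}" for v
    using closed_vimage [OF closed_nonneg_Reals_complex continuous_on_cinner_mult_vec [of UNIV v v]]
    by (simp add: vimage_def)
  then show ?thesis
    unfolding positive_op_def by (intro closed_Collect_all)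
qed

lemma convex_positive_op: "convex {X :: 'n::finite operator. positive_op X}"
  by (auto simp: convex_def intro: positive_op_add positive_op_scaleR)

lemma continuous_on_trace: "continuous_on A (trace :: 'n::finite operator \<Rightarrow> complex)"
  unfolding trace_def by (intro continuous_intros)

lemma op_scale_of_real: "op_scale (of_real r) X = r *\<^sub>R X"
  by (simp add: op_scale_def vec_eq_iff scaleR_conv_of_real [where 'a = complex])

text \<open>The vectors \<open>axis i 1 + c *s axis j 1\<close> with \<open>c\<close> equal to 1 and
  \<i> isolate the off-diagonal entries. Hence expectation values determine an operator.\<close>

lemma op_eq_0_if_quadratic_form_0:
  fixes X :: "'n::finite operator"
  assumes "\<And>v. cinner v (X *v v) = 0"
  shows "X = 0"
proof -
  have diag: "X $ i $ i = 0" for i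
    using assms [of "axis i 1"] by (simp add: cinner_axis_axis)
  have "X $ i $ j = 0" for i j
  proof -
    have "c * X $ i $ j + cnj c * X $ j $ i = 0" for c
      using assms [of "axis i 1 + c *s axis j 1"]
      by (simp add: matrix_vector_right_distrib vector_scalar_commute cinner_add_left
          cinner_add_right cinner_scale_left cinner_scale_right cinner_axis_axis diag add.commute)
    from this [of 1] this [of \<i>] show ?thesis by (simp add: complex_eq_iff)
  qed
  then show ?thesis by (simp add: vec_eq_iff)
qed

lemma norm_op_scale: "norm (op_scale c X) = cmod c * norm X"
proof -
  have "norm (op_scale c X $ i) = cmod c * norm (X $ i)" for i
    by (simp add: op_scale_def norm_vec_def norm_mult L2_set_right_distrib)
  then show ?thesis
    by (simp add: norm_vec_def [of "op_scale c X"] norm_vec_def [of X] L2_set_right_distrib)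
qed

lemma op_scale_polarization:
  "op_scale 4 (\<chi> i j. x $ i * cnj (y $ j)) =
    ket_bra (x + y) + op_scale (- 1) (ket_bra (x - y))
    + op_scale \<i> (ket_bra (x + \<i> *s y)) + op_scale (- \<i>) (ket_bra (x - \<i> *s y))"
  by (simp add: vec_eq_iff op_scale_def ket_bra_def algebra_simps)

text \<open>Polarization writes each matrix unit through four \<open>ket_bra\<close> operators, so
  these span over the complex numbers. The rule extends bounds from positive to arbitrary
  operators.\<close>

lemma op_induct [case_names ket_bra add scale]:
  fixes X :: "'n::finite operator"
  assumes ket_bra: "\<And>v. Q (ket_bra v)"
    and add: "\<And>X Y. Q X \<Longrightarrow> Q Y \<Longrightarrow> Q (X + Y)"
    and scale: "\<And>c X. Q X \<Longrightarrow> Q (op_scale c X)"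
  shows "Q X"
proof -
  have zero: "Q 0"
  proof -
    have "ket_bra 0 = (0 :: 'n operator)" by (simp add: ket_bra_def vec_eq_iff)
    then show ?thesis using ket_bra [of 0] by simp
  qed
  have sum: "Q (sum g A)" if "\<And>a. a \<in> A \<Longrightarrow> Q (g a)" for g and A :: "'n set"
    using that by (induction A rule: infinite_finite_induct) (auto intro: zero add)
  define e where "e i = (axis i 1 :: complex ^ 'n)" for i
  define U where "U i j = (\<chi> k l. e i $ k * cnj (e j $ l))" for i j
  have "Q (op_scale (1 / 4) (op_scale 4 (U i j)))" for i j
    unfolding U_def op_scale_polarization by (intro scale add ket_bra)
  moreover have "op_scale (1 / 4) (op_scale 4 Y) = Y" for Y :: "'n operator"
    by (simp add: op_scale_def vec_eq_iff)
  ultimately have "Q (\<Sum>i\<in>UNIV. \<Sum>j\<in>UNIV. op_scale (X $ i $ j) (U i j))"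
    by (intro sum scale) simp
  also have "(\<Sum>i\<in>UNIV. \<Sum>j\<in>UNIV. op_scale (X $ i $ j) (U i j)) = X"
  proof -
    have "(\<Sum>i\<in>UNIV. \<Sum>j\<in>UNIV. X $ i $ j * (e i $ k * cnj (e j $ l))) = X $ k $ l" for k l
    proof -
      have "(\<Sum>j\<in>UNIV. X $ i $ j * (e i $ k * cnj (e j $ l))) = X $ i $ l * e i $ k" for i
        by (simp add: e_def axis_def if_distrib [of cnj] if_distrib [of "\<lambda>x. _ * x"] cong: if_cong)
      then show ?thesis
        by (simp add: e_def axis_def if_distrib [of "\<lambda>x. _ * x"] cong: if_cong)
    qed
    then show ?thesis
      by (simp add: vec_eq_iff op_scale_def U_def)
  qed
  finally show ?thesis .
qed

subsection \<open>Partial traces\<close>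

lemma sum_UNIV_prod: "(\<Sum>p\<in>UNIV. g p) = (\<Sum>i\<in>UNIV. \<Sum>j\<in>UNIV. g (i, j))"
  for g :: "'a::finite \<times> 'b::finite \<Rightarrow> 'c::comm_monoid_add"
  by (simp add: sum.cartesian_product flip: UNIV_Times_UNIV)

definition tensor_vec :: "complex ^ 'm \<Rightarrow> complex ^ 'n \<Rightarrow> complex ^ ('m \<times> 'n)" where
  "tensor_vec v w = (\<chi> p. v $ fst p * w $ snd p)"

definition swap_op :: "('m::finite \<times> 'n::finite) operator \<Rightarrow> ('n \<times> 'm) operator" where
  "swap_op T = (\<chi> p q. T $ prod.swap p $ prod.swap q)"

text \<open>The partial trace \<open>Tr\<^sub>1 ((|v\<rangle>\<langle>v| \<otimes> 1) T)\<close>: the unnormalised state of the second factor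
  after the outcome \<open>v\<close> on the first.\<close>

definition slice :: "complex ^ 'm \<Rightarrow> ('m::finite \<times> 'n::finite) operator \<Rightarrow> 'n operator" where
  "slice v T = (\<chi> i j. \<Sum>k\<in>UNIV. \<Sum>l\<in>UNIV. cnj (v $ k) * T $ (k, i) $ (l, j) * v $ l)"

text \<open>A slice is tested by product vectors, which is how positivity passes from
  \<open>T\<close> to its slices.\<close>

lemma cinner_slice:
  "cinner w (slice v T *v w) = cinner (tensor_vec v w) (T *v tensor_vec v w)"
proof -
  define h where "h k i l j = cnj (v $ k) * T $ (k, i) $ (l, j) * v $ l * (cnj (w $ i) * w $ j)" for k i l j
  have "cinner w (slice v T *v w) = (\<Sum>i\<in>UNIV. \<Sum>j\<in>UNIV. \<Sum>k\<in>UNIV. \<Sum>l\<in>UNIV. h k i l j)"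
    by (simp add: cinner_def slice_def matrix_vector_mult_def h_def sum_distrib_left
        sum_distrib_right mult_ac)
  also have "\<dots> = (\<Sum>i\<in>UNIV. \<Sum>k\<in>UNIV. \<Sum>j\<in>UNIV. \<Sum>l\<in>UNIV. h k i l j)"
    by (intro sum.cong refl sum.swap)
  also have "\<dots> = (\<Sum>k\<in>UNIV. \<Sum>i\<in>UNIV. \<Sum>j\<in>UNIV. \<Sum>l\<in>UNIV. h k i l j)"
    by (rule sum.swap)
  also have "\<dots> = (\<Sum>k\<in>UNIV. \<Sum>i\<in>UNIV. \<Sum>l\<in>UNIV. \<Sum>j\<in>UNIV. h k i l j)"
    by (intro sum.cong refl sum.swap)
  also have "\<dots> = (\<Sum>p\<in>UNIV. \<Sum>q\<in>UNIV. h (fst p) (snd p) (fst q) (snd q))"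
    by (simp add: sum_UNIV_prod)
  also have "\<dots> = cinner (tensor_vec v w) (T *v tensor_vec v w)"
    by (simp add: cinner_def tensor_vec_def matrix_vector_mult_def h_def sum_distrib_left mult_ac)
  finally show ?thesis .
qed

lemma cinner_swap_op:
  "cinner w (swap_op T *v w) = cinner (\<chi> p. w $ prod.swap p) (T *v (\<chi> p. w $ prod.swap p))"
proof -
  have "(\<Sum>q\<in>UNIV. T $ p $ prod.swap q * w $ q) = (\<Sum>q\<in>UNIV. T $ p $ q * w $ prod.swap q)" for p
    by (rule sum.reindex_bij_witness [of _ prod.swap prod.swap]) auto
  moreover have "(\<Sum>p\<in>UNIV. cnj (w $ p) * g (prod.swap p)) = (\<Sum>p\<in>UNIV. cnj (w $ prod.swap p) * g p)"
    for g
    by (rule sum.reindex_bij_witness [of _ prod.swap prod.swap]) auto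
  ultimately show ?thesis
    by (simp add: cinner_def swap_op_def matrix_vector_mult_def)
qed

text \<open>Both sides are the form of \<open>T\<close> at the product of \<open>v\<close> and
  \<open>w\<close>, so conditioning on one factor can be traded for conditioning on the
  other.\<close>

lemma cinner_slice_swap_op:
  "cinner v (slice w (swap_op T) *v v) = cinner w (slice v T *v w)"
proof -
  have "(\<chi> p. tensor_vec w v $ prod.swap p) = tensor_vec v w"
    by (simp add: tensor_vec_def mult.commute)
  then show ?thesis by (simp only: cinner_slice cinner_swap_op)
qed

lemma positive_slice: "positive_op T \<Longrightarrow> positive_op (slice v T)"
  by (simp add: positive_op_def cinner_slice)

lemma positive_swap_op: "positive_op T \<Longrightarrow> positive_op (swap_op T)"
  by (simp add: positive_op_def cinner_swap_op)

text \<open>The weight of the outcome \<open>v\<close> depends only on the marginal of the measured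
  factor. This later identifies the eigenvalues.\<close>

lemma trace_slice: "trace (slice v T) = cinner v (trace_out_snd T *v v)"
proof -
  have "trace (slice v T) = (\<Sum>i\<in>UNIV. \<Sum>k\<in>UNIV. \<Sum>l\<in>UNIV. cnj (v $ k) * T $ (k, i) $ (l, i) * v $ l)"
    by (simp add: trace_def slice_def)
  also have "\<dots> = (\<Sum>k\<in>UNIV. \<Sum>i\<in>UNIV. \<Sum>l\<in>UNIV. cnj (v $ k) * T $ (k, i) $ (l, i) * v $ l)"
    by (rule sum.swap)
  also have "\<dots> = (\<Sum>k\<in>UNIV. \<Sum>l\<in>UNIV. \<Sum>i\<in>UNIV. cnj (v $ k) * T $ (k, i) $ (l, i) * v $ l)"
    by (intro sum.cong refl sum.swap)
  also have "\<dots> = cinner v (trace_out_snd T *v v)"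
    by (simp add: cinner_def trace_out_snd_def matrix_vector_mult_def sum_distrib_left
        sum_distrib_right mult_ac)
  finally show ?thesis .
qed

text \<open>Adding up the outcomes of a measurement in an orthonormal basis amounts to ignoring the
  measured factor; the partial trace thereby inherits positivity.\<close>

lemma trace_out_fst_eq_sum_slice: "trace_out_fst T = (\<Sum>k\<in>UNIV. slice (axis k 1) T)"
  by (simp add: vec_eq_iff trace_out_fst_def slice_def axis_def if_distrib [of cnj]
      if_distrib [of "\<lambda>x. _ * x"] if_distrib [of "\<lambda>x. x * _"] cong: if_cong)

lemma positive_trace_out_fst:
  assumes "positive_op T" shows "positive_op (trace_out_fst T)"
proof -
  have "positive_op (sum g A)" if "\<And>a. positive_op (g a)" for g :: "'a \<Rightarrow> 'b operator" and A :: "'a set"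
    using that by (induction A rule: infinite_finite_induct) (auto intro: positive_op_0 positive_op_add)
  then show ?thesis
    unfolding trace_out_fst_eq_sum_slice by (simp add: positive_slice [OF assms])
qed

lemma trace_trace_out_fst: "trace (trace_out_fst T) = trace T"
proof -
  have "trace T = (\<Sum>k\<in>UNIV. \<Sum>i\<in>UNIV. T $ (k, i) $ (k, i))"
    by (simp add: trace_def sum_UNIV_prod)
  also have "\<dots> = trace (trace_out_fst T)"
    unfolding trace_def trace_out_fst_def by (subst sum.swap) simp
  finally show ?thesis by simp
qed

lemma trace_out_swap_op:
  "trace_out_fst (swap_op T) = trace_out_snd T" "trace_out_snd (swap_op T) = trace_out_fst T"
  by (simp_all add: trace_out_fst_def trace_out_snd_def swap_op_def)

lemma trace_swap_op: "trace (swap_op T) = trace T"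
  unfolding trace_def swap_op_def
  by (simp, rule sum.reindex_bij_witness [of _ prod.swap prod.swap]) auto

text \<open>At a test vector \<open>w\<close> the claim compares, for the operator on the first
  factor conditioned on \<open>w\<close>, its form at \<open>v\<close> with its trace; this is
  \<open>cinner_le_trace\<close>.\<close>

lemma slice_le_trace_out_fst:
  assumes T: "positive_op T"
  shows "positive_op ((norm v)\<^sup>2 *\<^sub>R trace_out_fst T - slice v T)"
  unfolding positive_op_def
proof
  fix w
  let ?M = "slice w (swap_op T)"
  have "positive_op ?M" by (intro positive_slice positive_swap_op T)
  then have "Re (cinner v (?M *v v)) \<le> (norm v)\<^sup>2 * Re (trace ?M)"
    by (rule cinner_le_trace)
  moreover have "trace ?M = cinner w (trace_out_fst T *v w)"
    by (simp add: trace_slice trace_out_swap_op)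
  moreover have "Im (cinner w (slice v T *v w)) = 0" "Im (cinner w (trace_out_fst T *v w)) = 0"
    by (intro positive_opD positive_slice positive_trace_out_fst T)+
  ultimately show "cinner w (((norm v)\<^sup>2 *\<^sub>R trace_out_fst T - slice v T) *v w) \<in> \<real>\<^sub>\<ge>\<^sub>0"
    by (simp add: matrix_vector_mult_diff_rdistrib cinner_diff_right cinner_scaleR_mult_vec
        cinner_slice_swap_op complex_nonneg_Reals_iff del: of_real_power)
qed

lemma linear_slice: "linear (slice v)"
  by (rule linearI) (simp_all add: slice_def vec_eq_iff algebra_simps sum.distrib scaleR_sum_right)

lemma linear_trace_out_fst: "linear trace_out_fst"
  by (rule linearI) (simp_all add: trace_out_fst_def vec_eq_iff sum.distrib scaleR_sum_right)

lemma linear_trace_out_snd: "linear trace_out_snd"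
  by (rule linearI) (simp_all add: trace_out_snd_def vec_eq_iff sum.distrib scaleR_sum_right)

subsection \<open>Orthogonality from a perfectly distinguishing functional\<close>

lemma ket_bra_add_scaleR:
  "ket_bra (u + t *\<^sub>R w) = ket_bra u + t *\<^sub>R (ket_bra (u + w) - ket_bra u - ket_bra w) + t\<^sup>2 *\<^sub>R ket_bra w"
  by (simp add: ket_bra_def vec_eq_iff algebra_simps scaleR_conv_of_real [where 'a = complex] power2_eq_square)

text \<open>Degenerate Cauchy-Schwarz: along \<open>u + t *\<^sub>R w\<close> the value of
  \<open>h\<close> has no quadratic term, and an affine function of \<open>t\<close> that stays
  nonnegative is constant.\<close>

lemma positive_functional_cross_term:
  fixes h :: "'n::finite operator \<Rightarrow> real"
  assumes lin: "linear h" and pos: "\<And>X. positive_op X \<Longrightarrow> 0 \<le> h X"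
    and w: "h (ket_bra w) = 0"
  shows "h (ket_bra (u + w) - ket_bra u - ket_bra w) = 0"
proof (rule ccontr)
  let ?k = "h (ket_bra (u + w) - ket_bra u - ket_bra w)"
  assume k: "?k \<noteq> 0"
  have "0 \<le> h (ket_bra u) + t * ?k" for t
    using pos [OF positive_ket_bra [of "u + t *\<^sub>R w"]]
    by (simp only: ket_bra_add_scaleR linear_add [OF lin] linear_cmul [OF lin] w) simp
  \<comment> \<open>At this \<open>t\<close> the affine function equals -1.\<close>
  from this [of "- (h (ket_bra u) + 1) / ?k"] k show False by simp
qed

text \<open>Both \<open>h\<close> and its complement, the trace minus \<open>h\<close>, are
  positive; one kills \<open>w\<close>, the other \<open>u\<close>, so both vanish on the cross term
  of \<open>u\<close> and \<open>w\<close>. Hence the trace of that term, twice the real part of the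
  inner product, vanishes too.\<close>

lemma cinner_eq_0_if_separated:
  fixes h :: "'n::finite operator \<Rightarrow> real"
  assumes lin: "linear h" and pos: "\<And>X. positive_op X \<Longrightarrow> 0 \<le> h X"
    and le: "\<And>X. positive_op X \<Longrightarrow> h X \<le> Re (trace X)"
    and u: "h (ket_bra u) = Re (trace (ket_bra u))" and w: "h (ket_bra w) = 0"
  shows "cinner u w = 0"
proof -
  define g where "g X = Re (trace X) - h X" for X
  have lin_g: "linear g"
    unfolding g_def
    by (intro linear_compose_sub lin linearI) (simp_all add: trace_add trace_scaleR)
  have Re0: "Re (cinner u w) = 0" if w: "h (ket_bra w) = 0" for w
  proof -
    let ?K = "ket_bra (u + w) - ket_bra u - ket_bra w"
    have "h ?K = 0"
      by (rule positive_functional_cross_term [OF lin pos w])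
    moreover have "g (ket_bra (w + u) - ket_bra w - ket_bra u) = 0"
      by (rule positive_functional_cross_term [OF lin_g]) (simp_all add: g_def le u)
    moreover have "ket_bra (w + u) - ket_bra w - ket_bra u = ?K"
      by (simp add: algebra_simps)
    ultimately have "Re (trace ?K) = 0" by (simp add: g_def)
    moreover have "trace ?K = cinner u w + cinner w u"
      by (simp add: trace_sub trace_ket_bra cinner_add_left cinner_add_right
          del: of_real_power flip: cinner_self)
    ultimately show ?thesis
      using arg_cong [OF cnj_cinner [of u w], of Re] by simp
  qed
  \<comment> \<open>A phase leaves \<open>ket_bra w\<close> unchanged, so the same argument for
    \<open>\<i> *s w\<close> handles the imaginary part.\<close>
  have "ket_bra (\<i> *s w) = ket_bra w"
    by (simp add: ket_bra_def vec_eq_iff complex_eq_iff)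
  then have "Re (cinner u (\<i> *s w)) = 0" using Re0 w by metis
  then show ?thesis using Re0 [OF w] by (simp add: cinner_scale_right complex_eq_iff)
qed

lemma matrix_add_rdistrib: "(A + B) ** C = A ** C + B ** C" for A :: "'a::semiring_1 ^ 'n ^ 'm"
  by (simp add: vec_eq_iff matrix_matrix_mult_def ring_distribs sum.distrib)

lemma sum_list_ket_bra_mult_eq_0:
  assumes "\<And>u w. u \<in> set us \<Longrightarrow> w \<in> set ws \<Longrightarrow> cinner u w = 0"
  shows "(\<Sum>u\<leftarrow>us. ket_bra u) ** (\<Sum>w\<leftarrow>ws. ket_bra w) = 0"
proof -
  have left: "ket_bra u ** (\<Sum>w\<leftarrow>ws. ket_bra w) = 0" if "\<And>w. w \<in> set ws \<Longrightarrow> cinner u w = 0" for u ws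
    using that by (induction ws) (auto simp: matrix_add_ldistrib ket_bra_mult_ket_bra_eq_0)
  show ?thesis
    using assms by (induction us) (auto simp: matrix_add_rdistrib left)
qed

text \<open>Rank-one decompositions reduce this to vectors: nonnegative terms with sum zero all
  vanish, for \<open>h\<close> on the terms of \<open>Y\<close> and for its complement on those of
  \<open>X\<close>.\<close>

lemma mult_eq_0_if_separated:
  fixes h :: "'n::finite operator \<Rightarrow> real"
  assumes X: "positive_op X" and Y: "positive_op Y"
    and lin: "linear h" and pos: "\<And>X. positive_op X \<Longrightarrow> 0 \<le> h X"
    and le: "\<And>X. positive_op X \<Longrightarrow> h X \<le> Re (trace X)"
    and hX: "h X = Re (trace X)" and hY: "h Y = 0"
  shows "X ** Y = 0"
proof -
  obtain us ws where us: "X = (\<Sum>u\<leftarrow>us. ket_bra u)" and ws: "Y = (\<Sum>w\<leftarrow>ws. ket_bra w)"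
    using positive_op_eq_sum_ket_bra X Y by metis
  have zero: "\<forall>u\<in>set us. g (ket_bra u) = 0"
    if lin: "linear g" and pos: "\<And>X. positive_op X \<Longrightarrow> 0 \<le> g X" and "g (\<Sum>u\<leftarrow>us. ket_bra u) = 0"
    for g :: "'n operator \<Rightarrow> real" and us
  proof -
    have "g (\<Sum>u\<leftarrow>us. ket_bra u) = (\<Sum>u\<leftarrow>us. g (ket_bra u))"
      by (induction us) (auto simp: linear_add [OF lin] linear_0 [OF lin])
    with that(3) have "(\<Sum>u\<leftarrow>us. g (ket_bra u)) = 0" by simp
    then show ?thesis
      by (subst (asm) sum_list_nonneg_eq_0_iff) (auto intro: pos positive_ket_bra)
  qed
  define g where "g X = Re (trace X) - h X" for X
  have lin_g: "linear g"
    unfolding g_def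
    by (intro linear_compose_sub lin linearI) (simp_all add: trace_add trace_scaleR)
  have "cinner u w = 0" if "u \<in> set us" "w \<in> set ws" for u w
  proof (rule cinner_eq_0_if_separated [OF lin pos le])
    show "h (ket_bra u) = Re (trace (ket_bra u))"
      using zero [OF lin_g, of us] that(1) hX le by (simp add: g_def us)
    show "h (ket_bra w) = 0"
      using zero [OF lin pos, of ws] that(2) hY by (simp add: ws)
  qed
  then show ?thesis unfolding us ws by (rule sum_list_ket_bra_mult_eq_0)
qed

subsection \<open>Fixed states of a positive map with equal marginals\<close>

text \<open>Abstract form of the symmetrised broadcasting map. Equality of the marginals lets the
  single channel \<open>marginal\<close> describe both copies.\<close>

locale exchangeable_map =
  fixes G :: "'n::finite operator \<Rightarrow> ('n \<times> 'n) operator"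
  assumes add: "G (X + Y) = G X + G Y"
    and scale: "G (op_scale c X) = op_scale c (G X)"
    and pos: "positive_op X \<Longrightarrow> positive_op (G X)"
    and equal_marginals: "trace_out_snd (G X) = trace_out_fst (G X)"
    and trace_G: "trace (G X) = trace X"
begin

definition marginal :: "'n operator \<Rightarrow> 'n operator" where
  "marginal X = trace_out_fst (G X)"

definition fixed_states :: "'n operator set" where
  "fixed_states = {\<rho>. density_operator \<rho> \<and> marginal \<rho> = \<rho>}"

lemma linear_G: "linear G"
  using add scale by (intro linearI) (auto simp flip: op_scale_of_real)

lemma linear_marginal: "linear marginal"
  using linear_compose [OF linear_G linear_trace_out_fst] by (simp add: marginal_def [abs_def] o_def)

lemma trace_marginal: "trace (marginal X) = trace X"
  by (simp add: marginal_def trace_trace_out_fst trace_G)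

lemma positive_marginal: "positive_op X \<Longrightarrow> positive_op (marginal X)"
  by (simp add: marginal_def positive_trace_out_fst pos)

lemma marginal_op_scale: "marginal (op_scale c X) = op_scale c (marginal X)"
  by (simp add: marginal_def scale) (simp add: trace_out_fst_def op_scale_def vec_eq_iff sum_distrib_left)

text \<open>On a \<open>ket_bra\<close> all iterates stay positive with the same trace, which bounds
  their norms; linearity carries this over to all operators.\<close>

lemma orbit_bounded: "\<exists>C. \<forall>k. norm ((marginal ^^ k) X) \<le> C"
proof (induction X rule: op_induct)
  case (ket_bra v)
  have "positive_op ((marginal ^^ k) (ket_bra v)) \<and> trace ((marginal ^^ k) (ket_bra v)) = trace (ket_bra v)" for k
    by (induction k) (auto simp: positive_ket_bra positive_marginal trace_marginal)
  then show ?case using norm_positive_op_le_trace by metis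
next
  case (add X Y)
  then obtain C D where CD: "\<And>k. norm ((marginal ^^ k) X) \<le> C" "\<And>k. norm ((marginal ^^ k) Y) \<le> D" by blast
  have "(marginal ^^ k) (X + Y) = (marginal ^^ k) X + (marginal ^^ k) Y" for k
    by (induction k) (auto simp: linear_add [OF linear_marginal])
  then have "norm ((marginal ^^ k) (X + Y)) \<le> C + D" for k
    using CD norm_triangle_mono by metis
  then show ?case by blast
next
  case (scale c X)
  then obtain C where C: "\<And>k. norm ((marginal ^^ k) X) \<le> C" by blast
  have "(marginal ^^ k) (op_scale c X) = op_scale c ((marginal ^^ k) X)" for k
    by (induction k) (auto simp: marginal_op_scale)
  then have "norm ((marginal ^^ k) (op_scale c X)) \<le> cmod c * C" for k
    by (simp add: norm_op_scale mult_left_mono C)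
  then show ?case by blast
qed

text \<open>The positive operators, and the operators of a given trace, form closed convex sets
  invariant under \<open>marginal\<close>, so the Cesaro limits stay inside.\<close>

lemma obtain_projection:
  obtains P where "linear P" "\<And>X. marginal (P X) = P X" "\<And>X. marginal X = X \<Longrightarrow> P X = X"
    "\<And>X. positive_op X \<Longrightarrow> positive_op (P X)" "\<And>X. trace (P X) = trace X"
proof -
  obtain P where P: "linear P" "\<And>X. marginal (P X) = P X" "\<And>X. marginal X = X \<Longrightarrow> P X = X"
    and inv: "\<And>K X. closed K \<Longrightarrow> convex K \<Longrightarrow> marginal ` K \<subseteq> K \<Longrightarrow> X \<in> K \<Longrightarrow> P X \<in> K"
    using cesaro_projection [OF linear_marginal orbit_bounded] by blast
  have "positive_op (P X)" if "positive_op X" for X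
    using inv [OF closed_positive_op convex_positive_op, of X] that positive_marginal by auto
  moreover have "trace (P X) = trace X" for X
  proof -
    have "closed {Y :: 'n operator. trace Y = trace X}"
      by (intro closed_Collect_eq continuous_on_trace continuous_intros)
    moreover have "convex {Y :: 'n operator. trace Y = trace X}"
      by (auto simp: convex_def trace_add trace_scaleR simp flip: distrib_right of_real_add)
    ultimately show ?thesis
      using inv [of "{Y. trace Y = trace X}" X] trace_marginal by (simp add: image_subset_iff)
  qed
  ultimately show thesis using P that by blast
qed

lemma fixed_statesI:
  assumes "positive_op X" "marginal X = X" "Re (trace X) > 0"
  shows "X /\<^sub>R Re (trace X) \<in> fixed_states"
proof -
  have "trace (X /\<^sub>R Re (trace X)) = of_real (inverse (Re (trace X))) * of_real (Re (trace X))"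
    using trace_positive(2) [OF assms(1)] by (metis trace_scaleR)
  with assms show ?thesis
    by (simp add: fixed_states_def density_operator_def positive_op_scaleR linear_cmul [OF linear_marginal]
        flip: of_real_mult)
qed

lemma fixed_statesD:
  assumes "\<rho> \<in> fixed_states"
  shows "positive_op \<rho>" "trace \<rho> = 1" "marginal \<rho> = \<rho>"
  using assms by (auto simp: fixed_states_def density_operator_def)

lemma fixed_states_eq:
  "fixed_states = {X. positive_op X} \<inter> {X. trace X = 1} \<inter> {X. marginal X = X}"
  by (auto simp: fixed_states_def density_operator_def)

lemma convex_fixed_states: "convex fixed_states"
proof -
  have "convex {X :: 'n operator. trace X = 1}"
    by (auto simp: convex_def trace_add trace_scaleR simp flip: of_real_add)
  moreover have "convex {X. marginal X = X}"
    by (auto simp: convex_def linear_add [OF linear_marginal] linear_cmul [OF linear_marginal])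
  ultimately show ?thesis
    unfolding fixed_states_eq by (intro convex_Int convex_positive_op)
qed

lemma compact_fixed_states: "compact fixed_states"
proof -
  have "continuous_on UNIV marginal"
    using linear_marginal by (simp add: linear_continuous_on linear_conv_bounded_linear)
  then have "closed fixed_states"
    unfolding fixed_states_eq
    by (intro closed_Int closed_positive_op closed_Collect_eq continuous_on_trace continuous_on_const
        continuous_on_id)
  moreover have "bounded fixed_states"
    unfolding bounded_iff using norm_positive_op_le_trace fixed_statesD by (metis one_complex.sel(1))
  ultimately show ?thesis by (simp add: compact_eq_bounded_closed)
qed

text \<open>Splitting \<open>c *\<^sub>R \<rho>\<close> into \<open>m\<close> and the rest exhibits
  \<rho>, after normalisation, as a mixture of two fixed states; extremality makes both equal to
  \<rho>.\<close>

lemma extreme_dominates_multiples: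
  assumes ext: "\<rho> extreme_point_of fixed_states"
    and m: "positive_op m" "marginal m = m" and dom: "positive_op (c *\<^sub>R \<rho> - m)"
  shows "m = Re (trace m) *\<^sub>R \<rho>"
proof -
  have \<rho>: "\<rho> \<in> fixed_states" using ext by (simp add: extreme_point_of_def)
  define t where "t = Re (trace m)"
  have t: "0 \<le> t" using trace_positive m by (simp add: t_def)
  let ?d = "c *\<^sub>R \<rho> - m"
  have trd: "Re (trace ?d) = c - t"
    by (simp add: trace_sub trace_scaleR t_def fixed_statesD [OF \<rho>])
  then have tc: "t \<le> c" using trace_positive(1) [OF dom] by simp
  have Fd: "marginal ?d = ?d"
    by (simp add: linear_diff [OF linear_marginal] linear_cmul [OF linear_marginal] m fixed_statesD [OF \<rho>])
  \<comment> \<open>At the two end values one of the parts has trace zero and cannot be normalised,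
    but then it is itself zero.\<close>
  consider "t = 0" | "t = c" | "0 < t" "t < c" using t tc by linarith
  then show ?thesis
  proof cases
    case 1
    then show ?thesis using positive_trace_0 [OF m(1)] by (simp add: t_def)
  next
    case 2
    then have "?d = 0" using positive_trace_0 [OF dom] trd by simp
    with 2 show ?thesis by (simp add: t_def)
  next
    case 3
    define a b where "a = m /\<^sub>R t" and "b = ?d /\<^sub>R (c - t)"
    have a: "a \<in> fixed_states" unfolding a_def t_def by (rule fixed_statesI) (use 3 m in \<open>simp_all add: t_def\<close>)
    have b: "b \<in> fixed_states" unfolding b_def using fixed_statesI [OF dom Fd] 3 trd by simp
    have "\<rho> = (1 - t / c) *\<^sub>R b + (t / c) *\<^sub>R a"
    proof -
      have "(1 - t / c) *\<^sub>R b = (1 / c) *\<^sub>R ?d" "(t / c) *\<^sub>R a = (1 / c) *\<^sub>R m"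
        using 3 by (simp_all add: a_def b_def divide_simps)
      then show ?thesis using 3 by (simp add: algebra_simps)
    qed
    moreover have "0 < t / c" "t / c < 1" using 3 by simp_all
    ultimately have "b \<noteq> a \<Longrightarrow> \<rho> \<in> open_segment b a"
      unfolding in_segment by blast
    then have "b = a" using ext a b by (auto simp: extreme_point_of_def)
    with \<open>\<rho> = _\<close> have "\<rho> = a" by (simp add: algebra_simps flip: scaleR_add_left)
    then show ?thesis using 3 by (simp add: a_def t_def [symmetric])
  qed
qed

text \<open>Domination of the slice by a multiple of \<rho> survives \<open>P\<close>, which is
  positive and fixes \<rho>. The factor is the trace of the slice, hence read off from the other
  marginal, which is again \<rho>.\<close>

lemma extreme_eigenvector:
  assumes P: "linear P" "\<And>X. marginal (P X) = P X" "\<And>X. marginal X = X \<Longrightarrow> P X = X"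
    "\<And>X. positive_op X \<Longrightarrow> positive_op (P X)" "\<And>X. trace (P X) = trace X"
    and ext: "\<rho> extreme_point_of fixed_states"
  shows "P (slice v (G \<rho>)) = Re (cinner v (\<rho> *v v)) *\<^sub>R \<rho>"
proof -
  have \<rho>: "\<rho> \<in> fixed_states" using ext by (simp add: extreme_point_of_def)
  have G\<rho>: "positive_op (G \<rho>)" by (rule pos [OF fixed_statesD(1) [OF \<rho>]])
  have marg: "trace_out_fst (G \<rho>) = \<rho>" using fixed_statesD(3) [OF \<rho>] by (simp add: marginal_def)
  have "positive_op (P ((norm v)\<^sup>2 *\<^sub>R \<rho> - slice v (G \<rho>)))"
    using slice_le_trace_out_fst [OF G\<rho>, of v] marg P(4) by metis
  then have "positive_op ((norm v)\<^sup>2 *\<^sub>R \<rho> - P (slice v (G \<rho>)))"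
    using P(3) fixed_statesD(3) [OF \<rho>] by (simp add: linear_diff [OF P(1)] linear_cmul [OF P(1)])
  from extreme_dominates_multiples [OF ext P(4) P(2) this] positive_slice [OF G\<rho>]
  have "P (slice v (G \<rho>)) = Re (trace (P (slice v (G \<rho>)))) *\<^sub>R \<rho>" by blast
  then show ?thesis
    by (simp add: P(5) trace_slice equal_marginals marg)
qed

text \<open>The eigenvalues are the expectation values at all \<open>v\<close>, and these tell
  distinct states apart.\<close>

lemma independent_extreme_points: "independent {\<rho>. \<rho> extreme_point_of fixed_states}"
proof -
  obtain P where P: "linear P" "\<And>X. marginal (P X) = P X" "\<And>X. marginal X = X \<Longrightarrow> P X = X"
    "\<And>X. positive_op X \<Longrightarrow> positive_op (P X)" "\<And>X. trace (P X) = trace X"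
    using obtain_projection by blast
  define L where "L v X = P (slice v (G X))" for v X
  define q where "q v X = Re (cinner v (X *v v))" for v and X :: "'n operator"
  have ext: "\<rho> \<in> fixed_states" if "\<rho> extreme_point_of fixed_states" for \<rho>
    using that by (simp add: extreme_point_of_def)
  show ?thesis
  proof (rule independent_if_separated_eigenvectors [where L = L and q = q])
    show "linear (L v)" for v
      using linear_compose [OF linear_compose [OF linear_G linear_slice] P(1)]
      by (simp add: L_def [abs_def] o_def)
    show "L v b = q v b *\<^sub>R b" if "b \<in> {\<rho>. \<rho> extreme_point_of fixed_states}" for v b
      unfolding L_def q_def using extreme_eigenvector [OF P] that by blast
    show "b = c" if "b \<in> {\<rho>. \<rho> extreme_point_of fixed_states}"
      "c \<in> {\<rho>. \<rho> extreme_point_of fixed_states}" and q: "\<And>v. q v b = q v c" for b c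
    proof -
      have "positive_op b" "positive_op c" using that ext fixed_statesD by auto
      then have "cinner v ((b - c) *v v) = 0" for v
        using q [of v] positive_opD(2) [of b v] positive_opD(2) [of c v]
        by (simp add: q_def matrix_vector_mult_diff_rdistrib cinner_diff_right complex_eq_iff)
      then have "b - c = 0" by (rule op_eq_0_if_quadratic_form_0)
      then show ?thesis by simp
    qed
    show "0 \<notin> {\<rho>. \<rho> extreme_point_of fixed_states}"
    proof
      assume "0 \<in> {\<rho>. \<rho> extreme_point_of fixed_states}"
      then have "trace (0 :: 'n operator) = 1" using ext fixed_statesD(2) by blast
      then show False by (simp add: trace_def)
    qed
  qed
qed

lemma fixed_states_eq_hull: "fixed_states = convex hull {\<rho>. \<rho> extreme_point_of fixed_states}"
  by (rule Krein_Milman_Minkowski [OF compact_fixed_states convex_fixed_states])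

lemma extreme_points_orthogonal:
  assumes \<rho>: "\<rho> extreme_point_of fixed_states" and \<tau>: "\<tau> extreme_point_of fixed_states" and "\<rho> \<noteq> \<tau>"
  shows "\<rho> ** \<tau> = 0"
proof -
  obtain P where P: "linear P" "\<And>X. marginal (P X) = P X" "\<And>X. marginal X = X \<Longrightarrow> P X = X"
    "\<And>X. positive_op X \<Longrightarrow> positive_op (P X)" "\<And>X. trace (P X) = trace X"
    using obtain_projection by blast
  \<comment> \<open>The coordinate functional of \<rho>; independence of the extreme points permits
    prescribing its values on them.\<close>
  obtain f :: "'n operator \<Rightarrow> real" where f: "linear f"
    and f_ext: "\<And>b. b extreme_point_of fixed_states \<Longrightarrow> f b = (if b = \<rho> then 1 else 0)"
    using linear_independent_extend [OF independent_extreme_points, of "\<lambda>b. if b = \<rho> then 1 else 0"]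
    by auto
  have "convex hull {\<rho>. \<rho> extreme_point_of fixed_states} \<subseteq> f -` {0..1}"
    by (rule hull_minimal) (auto simp: f_ext convex_linear_vimage [OF f])
  then have f01: "0 \<le> f X" "f X \<le> 1" if "X \<in> fixed_states" for X
    using that fixed_states_eq_hull by auto
  \<comment> \<open>Composing with \<open>P\<close> makes \<open>f\<close> an effect on all positive
    operators: \<open>P X\<close> is normalised to a fixed state, and trace zero forces
    \<open>X\<close> to be 0.\<close>
  have bounds: "0 \<le> f (P X) \<and> f (P X) \<le> Re (trace X)" if X: "positive_op X" for X
  proof (cases "Re (trace X) = 0")
    case True
    then show ?thesis
      using positive_trace_0 [OF X] by (simp add: linear_0 [OF f] linear_0 [OF P(1)])
  next
    case False
    then have t: "Re (trace X) > 0" using trace_positive(1) [OF X] by simp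
    then have "P X /\<^sub>R Re (trace X) \<in> fixed_states"
      using fixed_statesI [of "P X"] P(2,5) P(4) [OF X] by simp
    from f01 [OF this] show ?thesis
      using t by (simp add: linear_cmul [OF f] divide_simps)
  qed
  have mem: "\<rho> \<in> fixed_states" "\<tau> \<in> fixed_states"
    using \<rho> \<tau> by (simp_all add: extreme_point_of_def)
  show ?thesis
  proof (rule mult_eq_0_if_separated [where h = "\<lambda>X. f (P X)"])
    show "linear (\<lambda>X. f (P X))" using linear_compose [OF P(1) f] by (simp add: o_def)
    show "f (P \<rho>) = Re (trace \<rho>)"
      using P(3) [OF fixed_statesD(3) [OF mem(1)]] fixed_statesD(2) [OF mem(1)] f_ext [OF \<rho>] by simp
    show "f (P \<tau>) = 0"
      using P(3) [OF fixed_statesD(3) [OF mem(2)]] f_ext [OF \<tau>] \<open>\<rho> \<noteq> \<tau>\<close> by simp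
  qed (use bounds mem fixed_statesD in auto)
qed

text \<open>Lets commutation spread from the extreme points to their convex hull.\<close>

lemma convex_commutant: "convex {X. A ** X = X ** A}" for A :: "'n operator"
proof -
  have scaleR: "A ** (r *\<^sub>R X) = r *\<^sub>R (A ** X)" "(r *\<^sub>R X) ** A = r *\<^sub>R (X ** A)" for r and X :: "'n operator"
    by (simp_all add: matrix_matrix_mult_def vec_eq_iff scaleR_sum_right)
  show ?thesis
    by (auto simp: convex_def matrix_add_ldistrib matrix_add_rdistrib scaleR)
qed

text \<open>Distinct extreme points have product zero in either order, hence commute. The passage to
  the hull is made once for each argument.\<close>

lemma fixed_states_commute:
  assumes "\<rho> \<in> fixed_states" "\<tau> \<in> fixed_states"
  shows "\<rho> ** \<tau> = \<tau> ** \<rho>"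
proof -
  let ?E = "{\<rho>. \<rho> extreme_point_of fixed_states}"
  have "a ** b = b ** a" if "a \<in> ?E" "b \<in> ?E" for a b
    using that extreme_points_orthogonal by (cases "a = b") auto
  then have "convex hull ?E \<subseteq> {X. a ** X = X ** a}" if "a \<in> ?E" for a
    using that by (intro hull_minimal convex_commutant) blast
  then have "a ** \<tau> = \<tau> ** a" if "a \<in> ?E" for a
    using that assms(2) fixed_states_eq_hull by blast
  then have "convex hull ?E \<subseteq> {X. \<tau> ** X = X ** \<tau>}"
    by (intro hull_minimal convex_commutant) fastforce
  then show ?thesis using assms(1) fixed_states_eq_hull by fastforce
qed

end

section \<open>From completely positive broadcasting maps to exchangeable maps\<close>

lemma positive_block_1: "positive_block 1 (\<lambda>i j. X) \<longleftrightarrow> positive_op X"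
proof -
  have "positive_block 1 (\<lambda>i j. X) \<longleftrightarrow> (\<forall>v :: nat \<Rightarrow> _. cinner (v 0) (X *v v 0) \<in> \<real>\<^sub>\<ge>\<^sub>0)"
    by (simp add: positive_block_def)
  also have "\<dots> \<longleftrightarrow> positive_op X"
    unfolding positive_op_def
  proof safe
    fix \<psi>
    assume "\<forall>v :: nat \<Rightarrow> _. cinner (v 0) (X *v v 0) \<in> \<real>\<^sub>\<ge>\<^sub>0"
    from spec [OF this, of "\<lambda>_. \<psi>"] show "cinner \<psi> (X *v \<psi>) \<in> \<real>\<^sub>\<ge>\<^sub>0" .
  qed simp
  finally show ?thesis .
qed

text \<open>The case of a one-dimensional ancilla.\<close>

lemma positive_if_completely_positive:
  assumes "completely_positive \<E>" "positive_op X"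
  shows "positive_op (\<E> X)"
proof -
  have "\<forall>k X. positive_block k X \<longrightarrow> positive_block k (\<lambda>i j. \<E> (X i j))"
    using assms(1) by (simp add: completely_positive_def)
  from this [rule_format, of 1 "\<lambda>i j. X"] show ?thesis
    using assms(2) by (simp only: positive_block_1)
qed

theorem no_broadcasting:
  fixes \<E> :: "('n::finite) operator \<Rightarrow> ('n \<times> 'n) operator"
  assumes cp: "completely_positive \<E>" and tp: "trace_preserving \<E>"
    and "density_operator \<sigma>" "density_operator \<tau>"
    and "broadcasting \<E> \<sigma>" "broadcasting \<E> \<tau>"
  shows "\<sigma> ** \<tau> = \<tau> ** \<sigma>"
proof -
  \<comment> \<open>The swap exchanges the two marginals, so both marginals of \<open>G\<close> are
    the mean of those of \<E>.\<close>
  define G where "G X = (1 / 2) *\<^sub>R (\<E> X + swap_op (\<E> X))" for X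
  have marg: "trace_out_fst (G X) = (1 / 2) *\<^sub>R (trace_out_fst (\<E> X) + trace_out_snd (\<E> X))"
    "trace_out_snd (G X) = (1 / 2) *\<^sub>R (trace_out_fst (\<E> X) + trace_out_snd (\<E> X))" for X
    unfolding G_def linear_cmul [OF linear_trace_out_fst] linear_add [OF linear_trace_out_fst]
      linear_cmul [OF linear_trace_out_snd] linear_add [OF linear_trace_out_snd]
    by (simp_all add: trace_out_swap_op)
  have lin: "\<E> (X + Y) = \<E> X + \<E> Y" "\<E> (op_scale c X) = op_scale c (\<E> X)" for X Y c
    using cp by (simp_all add: completely_positive_def linear_op_scale_iff)
  interpret exchangeable_map G
  proof
    show "G (X + Y) = G X + G Y" for X Y
      by (simp add: G_def lin) (simp add: swap_op_def vec_eq_iff algebra_simps)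
    show "G (op_scale c X) = op_scale c (G X)" for c X
      by (simp add: G_def lin) (simp add: swap_op_def op_scale_def vec_eq_iff algebra_simps)
    show "positive_op (G X)" if "positive_op X" for X
      unfolding G_def using positive_if_completely_positive [OF cp that]
      by (intro positive_op_scaleR positive_op_add positive_swap_op) simp_all
    show "trace_out_snd (G X) = trace_out_fst (G X)" for X
      by (simp add: marg)
    show "trace (G X) = trace X" for X
      using tp by (simp add: G_def trace_scaleR trace_add trace_swap_op trace_preserving_def)
  qed
  \<comment> \<open>For a broadcast state both marginals under \<E> are the state itself, and hence
    so is their mean.\<close>
  have "\<rho> \<in> fixed_states" if "density_operator \<rho>" "broadcasting \<E> \<rho>" for \<rho>
    using that by (simp add: fixed_states_def marginal_def marg broadcasting_def flip: scaleR_2)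
  then show ?thesis using fixed_states_commute assms by blast
qed

theorem theoremV6:
  fixes \<E> :: "('n::finite) operator \<Rightarrow> ('n \<times> 'n) operator"
    and \<sigma>\<^sub>1 \<sigma>\<^sub>2 :: "'n operator"
  assumes "completely_positive \<E>" and "trace_preserving \<E>"
    and "density_operator \<sigma>\<^sub>1" and "density_operator \<sigma>\<^sub>2"
    and "broadcasting \<E> \<sigma>\<^sub>1" and "broadcasting \<E> \<sigma>\<^sub>2"
    and "\<sigma>\<^sub>1 ** \<sigma>\<^sub>2 - \<sigma>\<^sub>2 ** \<sigma>\<^sub>1 \<noteq> 0"
  shows "\<exists>S. (\<forall>P\<in>S. pure_state P) \<and>
             (\<exists>P\<in>S. \<exists>Q\<in>S. P \<noteq> Q) \<and>
             pairwise nonorthogonal_nonidentical S \<and>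
             (\<forall>P\<in>S. cloning \<E> P)"
  \<comment> \<open>The commutation from \<open>no_broadcasting\<close> contradicts the last
    assumption, so the claim follows from falsity and no set \<open>S\<close> is
    constructed.\<close>
  using no_broadcasting [OF assms(1-6)] assms(7) by simp

end
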